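(* For a nested family as in the context, $\operatorname{conv}(X^{0,u})$ is the set of all $(z,\delta)\in\mathbb R^n\times\mathbb R^m$ satisfying the inequalities $0\le\sum_{j\in J}z_j\le u$; $z_j+\delta_i\le 1$ for all $i\in I$, $j\in S_i$; $1-\delta_1-\sum_{j\in S_1}z_j\le 0$; $\delta_{i+1}-\delta_i\le 0$ for $i=1,\dots,m-1$; $\delta_i-\delta_{i+1}-\sum_{j\in S_{i+1}\setminus S_i}z_j\le 0$ for $i=1,\dots,m-1$; $-\delta_m\le 0$; $-z_j\le 0$ for all $j\in J$; $z_j\le 1$ for all $j\in J\setminus S_m$; together with the inequalities $$\sum_{j\in S'}z_j+\bigl(u-|S'\setminus S_p|\bigr)\delta_p+\sum_{i=p+1}^m\bigl(|S'\setminus S_{i-1}|-|S'\setminus S_i|\bigr)\delta_i\le u$$ for all $p\in I$ and all $S'\subseteq J$ such that $|S'\setminus S_p|\le u-1$.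
   Context: Let $n,m$ be positive integers, $J=\{1,\dots,n\}$, $I=\{1,\dots,m\}$, and let $u\ge2$ be an integer. The sets are nested: $S_1\subsetneq S_2\subsetneq\dots\subsetneq S_m\subsetneq J$, with $|S_1|\ge 2$. Define $$X^{0,u}=\Bigl\{(z,\delta)\in\{0,1\}^n\times\{0,1\}^m:\ \delta_i=\prod_{j\in S_i}(1-z_j)\ (i\in I),\ 0\le\sum_{j\in J}z_j\le u\Bigr\}.$$ *)

theory Defs
  imports "HOL-Analysis.Analysis"
begin

text \<open>
  The ground set \<open>J = {1,\<dots>,n}\<close> is the index type \<open>'n\<close>, so \<open>J = UNIV\<close> and \<open>n = CARD('n)\<close>.
  The family is indexed by \<open>I = {1,\<dots>,m}\<close> as natural numbers with \<open>m = CARD('m)\<close>; since the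
  order of \<open>I\<close> matters, a bijection \<open>e\<close> from \<open>{1..CARD('m)}\<close> onto \<open>'m\<close> names the coordinates
  of \<open>\<delta>\<close>, and \<open>\<delta> $ e i\<close> is the \<open>i\<close>-th entry of \<open>\<delta>\<close>.  Only the values \<open>S i\<close> with
  \<open>1 \<le> i \<le> CARD('m)\<close> are relevant.
\<close>

definition nested_family :: "'m::finite itself \<Rightarrow> (nat \<Rightarrow> 'n::finite set) \<Rightarrow> bool" where
  "nested_family _ S \<longleftrightarrow>
     2 \<le> card (S 1) \<and>
     (\<forall>i\<in>{1..<CARD('m)}. S i \<subset> S (i + 1)) \<and>
     S CARD('m) \<subset> UNIV"

definition X0 :: "(nat \<Rightarrow> 'm::finite) \<Rightarrow> (nat \<Rightarrow> 'n::finite set) \<Rightarrow> nat \<Rightarrow> ((real^'n) \<times> (real^'m)) set" where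
  "X0 e S u = {(z, \<delta>).
     (\<forall>j. z $ j \<in> {0, 1}) \<and>
     (\<forall>i\<in>{1..CARD('m)}. \<delta> $ e i \<in> {0, 1}) \<and>
     (\<forall>i\<in>{1..CARD('m)}. \<delta> $ e i = (\<Prod>j\<in>S i. 1 - z $ j)) \<and>
     0 \<le> (\<Sum>j\<in>UNIV. z $ j) \<and> (\<Sum>j\<in>UNIV. z $ j) \<le> real u}"

end

theory Submission
  imports Defs
begin

text \<open>
  Put \<open>S\<^sub>0 = {}\<close>, \<open>\<delta>\<^sub>0 = 1\<close> and \<open>\<delta>\<^sub>m\<^sub>+\<^sub>1 = 0\<close>.  A feasible 0/1 point is the same as a set \<open>A\<close> of
  at most \<open>u\<close> elements, and it lies on one level: the largest \<open>k\<close> with \<open>A \<inter> S\<^sub>k = {}\<close>.  In a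
  convex combination of feasible points, the total weight on level \<open>k\<close> is forced to be
  \<open>w\<^sub>k = \<delta>\<^sub>k - \<delta>\<^sub>k\<^sub>+\<^sub>1\<close>.  All the inequalities are easily checked on a set \<open>A\<close>; the cover inequalities
  become transparent after summation by parts, when they read
  \<open>z(B) \<le> u * (w\<^sub>0 + \<dots> + w\<^sub>p\<^sub>-\<^sub>1) + (\<Sum>k=p..m. \<bar>B - S\<^sub>k\<bar> * w\<^sub>k)\<close>: a set on level \<open>k\<close> has at most
  \<open>min u \<bar>B - S\<^sub>k\<bar>\<close> elements in \<open>B\<close>.

  For the converse, suppose that \<open>(z, \<delta>)\<close> satisfies the inequalities but is not in the hull, and
  separate it from the hull by a linear functional, whose part on \<open>z\<close> is \<open>c\<close>.  It suffices to find
  sets \<open>A\<^sub>k\<close> on the levels \<open>k = 0, \<dots>, m\<close> with \<open>c(z) \<le> (\<Sum>k. w\<^sub>k * c(A\<^sub>k))\<close>: the combination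
  \<open>\<Sum>k. w\<^sub>k A\<^sub>k\<close> lies in the hull and has the \<open>\<delta>\<close>-part of the given point, so that the two
  together contradict the separation (\<open>exists_dominating_admissible\<close>).

  The sets \<open>A\<^sub>k\<close> are chosen greedily: for \<open>k < m\<close> the best element of \<open>S\<^sub>k\<^sub>+\<^sub>1 - S\<^sub>k\<close>,
  which is needed to be on level \<open>k\<close> exactly, and then the elements of largest positive \<open>c\<close> outside \<open>S\<^sub>k\<close> up to
  cardinality \<open>u\<close>.  Such a set meets every upper level set \<open>{c \<ge> t}\<close>, \<open>t > 0\<close>, in as many elements
  as any set on its level can, and every lower level set \<open>{c \<le> -t}\<close> in as few as possible
  (\<open>exists_greedy_admissible\<close>).  By the layer-cake formula for \<open>c\<close>
  (\<open>sum_mult_nonneg_by_level_sets\<close>) it is therefore enough to compare \<open>z\<close> with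
  \<open>\<Sum>k. w\<^sub>k A\<^sub>k\<close> on level sets, and there \<open>z\<close> is controlled by the inequalities: the cover
  inequalities give \<open>z(B) \<le> (\<Sum>k. w\<^sub>k * rank\<^sub>k B)\<close> (\<open>sum_le_level_rank\<close>), and the
  inequalities \<open>z(S\<^sub>k\<^sub>+\<^sub>1 - S\<^sub>k) \<ge> w\<^sub>k\<close> give the lower bound (\<open>sum_ge_contained_blocks\<close>).
\<close>

section \<open>Level sets and greedy sets\<close>

text \<open>
  Layer-cake principle: a nonnegative function is a nonnegative combination of the indicators of
  its upper level sets.  Instead of integrating over the threshold, the induction subtracts the
  least positive value of \<open>f\<close> on the support of \<open>f\<close>, which removes at least one point from the
  support and only shifts the thresholds.
\<close>

lemma sum_mult_nonneg_by_level_sets: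
  fixes f d :: "'a::finite \<Rightarrow> real"
  assumes "\<And>x. 0 \<le> f x"
    and "\<And>t. 0 < t \<Longrightarrow> 0 \<le> sum d {x. t \<le> f x}"
  shows "0 \<le> (\<Sum>x\<in>UNIV. f x * d x)"
  using assms
proof (induction "card {x. 0 < f x}" arbitrary: f rule: less_induct)
  case less
  show ?case
  proof (cases "{x. 0 < f x} = {}")
    case True
    then have "f x = 0" for x
      using less.prems(1)[of x] by (auto simp: not_less intro: antisym)
    then show ?thesis by simp
  next
    case False
    define t where "t = Min (f ` {x. 0 < f x})"
    define g where "g x = (if 0 < f x then f x - t else 0)" for x
    have t_le: "t \<le> f x" if "0 < f x" for x
      unfolding t_def using that by (intro Min_le) auto
    have "t \<in> f ` {x. 0 < f x}"
      unfolding t_def using False by (intro Min_in) auto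
    then obtain x0 where x0: "0 < f x0" "f x0 = t" by auto
    then have t_pos: "0 < t" by simp
    have sub: "{x. 0 < g x} \<subset> {x. 0 < f x}"
    proof
      show "{x. 0 < g x} \<subseteq> {x. 0 < f x}" by (auto simp: g_def split: if_splits)
      have "x0 \<notin> {x. 0 < g x}" using x0 by (simp add: g_def)
      then show "{x. 0 < g x} \<noteq> {x. 0 < f x}" using x0 by blast
    qed
    have "0 \<le> (\<Sum>x\<in>UNIV. g x * d x)"
    proof (rule less.hyps)
      show "card {x. 0 < g x} < card {x. 0 < f x}" using sub by (simp add: psubset_card_mono)
      show "0 \<le> g x" for x using t_le by (auto simp: g_def)
      fix s :: real assume s: "0 < s"
      have "{x. s \<le> g x} = {x. s + t \<le> f x}"
        using s t_pos by (auto simp: g_def)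
      then show "0 \<le> sum d {x. s \<le> g x}" using less.prems(2)[of "s + t"] s t_pos by simp
    qed
    moreover have "0 \<le> t * sum d {x. t \<le> f x}"
      using less.prems(2)[OF t_pos] t_pos by simp
    moreover have "f x * d x = g x * d x + t * (if t \<le> f x then d x else 0)" for x
      using t_le[of x] t_pos less.prems(1)[of x] by (auto simp: g_def algebra_simps)
    then have "(\<Sum>x\<in>UNIV. f x * d x) = (\<Sum>x\<in>UNIV. g x * d x) + t * sum d {x. t \<le> f x}"
      by (simp add: sum.distrib sum_distrib_left[symmetric] sum.If_cases)
    ultimately show ?thesis by linarith
  qed
qed

text \<open>
  One set is best for all positive thresholds at once: take elements of largest positive value of
  \<open>c\<close>, one after the other, until \<open>r\<close> are chosen or none is left.
\<close>

lemma exists_top_elements: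
  fixes c :: "'a \<Rightarrow> real"
  assumes "finite Y"
  shows "\<exists>B\<subseteq>Y. card B \<le> r \<and> (\<forall>j\<in>B. 0 < c j) \<and>
           (\<forall>t>0. min (card (Y \<inter> {j. t \<le> c j})) r \<le> card (B \<inter> {j. t \<le> c j}))"
  using assms
proof (induction r arbitrary: Y)
  case 0
  show ?case by (intro exI[of _ "{}"]) auto
next
  case (Suc r)
  show ?case
  proof (cases "\<exists>j\<in>Y. 0 < c j")
    case False
    then have "Y \<inter> {j. t \<le> c j} = {}" if "0 < t" for t using that by force
    then show ?thesis by (intro exI[of _ "{}"]) auto
  next
    case True
    then have ne: "Y \<noteq> {}" by auto
    obtain a where a: "a \<in> Y" "\<And>j. j \<in> Y \<Longrightarrow> c j \<le> c a"
      using ex_is_arg_min_if_finite[OF Suc.prems ne, of "\<lambda>j. - c j"]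
      by (auto simp: is_arg_min_linorder)
    have a_pos: "0 < c a" using True a(2) by force
    obtain B where B: "B \<subseteq> Y - {a}" "card B \<le> r" "\<forall>j\<in>B. 0 < c j"
      "\<And>t. 0 < t \<Longrightarrow> min (card ((Y - {a}) \<inter> {j. t \<le> c j})) r \<le> card (B \<inter> {j. t \<le> c j})"
      using Suc.IH[of "Y - {a}"] Suc.prems by auto
    have fB: "finite B" using B(1) Suc.prems by (meson finite_Diff finite_subset)
    have "min (card (Y \<inter> {j. t \<le> c j})) (Suc r) \<le> card (insert a B \<inter> {j. t \<le> c j})"
      if t: "0 < t" for t
    proof (cases "t \<le> c a")
      case True
      have "Y \<inter> {j. t \<le> c j} = insert a ((Y - {a}) \<inter> {j. t \<le> c j})"
        "insert a B \<inter> {j. t \<le> c j} = insert a (B \<inter> {j. t \<le> c j})"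
        using True a(1) by auto
      moreover have "a \<notin> B" using B(1) by auto
      ultimately show ?thesis using B(4)[OF t] fB Suc.prems by simp
    next
      case False
      then have "Y \<inter> {j. t \<le> c j} = {}" using a(2) by force
      then show ?thesis by simp
    qed
    moreover have "card (insert a B) \<le> Suc r" using B(2) fB by (simp add: card_insert_if)
    ultimately show ?thesis using B a(1) a_pos by (intro exI[of _ "insert a B"]) auto
  qed
qed

section \<open>Sets supported on one level of a chain\<close>

text \<open>
  The chain starts with the empty set, so that level \<open>0\<close> (sets meeting the first proper member) is
  treated like all others.
\<close>

locale set_chain =
  fixes R :: "nat \<Rightarrow> 'n::finite set" and M u :: nat
  assumes R_0: "R 0 = {}"
    and R_psubset: "k < M \<Longrightarrow> R k \<subset> R (Suc k)"
    and u_pos: "1 \<le> u"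
begin

definition admissible :: "nat \<Rightarrow> 'n set \<Rightarrow> bool" where
  "admissible k A \<longleftrightarrow> card A \<le> u \<and> A \<inter> R k = {} \<and> (k < M \<longrightarrow> A \<inter> R (Suc k) \<noteq> {})"

text \<open>
  The maximum of \<open>card (A \<inter> B)\<close> over the sets \<open>A\<close> that are admissible at level \<open>k\<close>: if \<open>B\<close> misses
  the block \<open>R (Suc k) - R k\<close>, then the element that \<open>A\<close> must have in this block is lost for \<open>B\<close>.
\<close>

definition level_rank :: "nat \<Rightarrow> 'n set \<Rightarrow> nat" where
  "level_rank k B =
     min (card (B - R k)) (if k < M \<and> B \<inter> (R (Suc k) - R k) = {} then u - 1 else u)"

lemma R_mono: "k \<le> l \<Longrightarrow> l \<le> M \<Longrightarrow> R k \<subseteq> R l"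
proof (induction l rule: dec_induct)
  case (step l)
  then show ?case using R_psubset[of l] by auto
qed simp

lemma sum_Union_blocks:
  fixes z :: "'n \<Rightarrow> real"
  assumes "L \<subseteq> {..<M}"
  shows "sum z (\<Union>k\<in>L. R (Suc k) - R k) = (\<Sum>k\<in>L. sum z (R (Suc k) - R k))"
proof (rule sum.UNION_disjoint)
  have disj: "(R (Suc k) - R k) \<inter> (R (Suc l) - R l) = {}" if "k < l" "l < M" for k l
    using R_mono[of "Suc k" l] that by auto
  show "\<forall>k\<in>L. \<forall>l\<in>L. k \<noteq> l \<longrightarrow> (R (Suc k) - R k) \<inter> (R (Suc l) - R l) = {}"
  proof (intro ballI impI)
    fix k l assume "k \<in> L" "l \<in> L" "k \<noteq> l"
    then show "(R (Suc k) - R k) \<inter> (R (Suc l) - R l) = {}"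
      using disj[of k l] disj[of l k] assms by (cases "k < l") (auto simp: Int_commute)
  qed
qed (use assms finite_subset in auto)

text \<open>
  The greedy set at level \<open>k < M\<close> consists of a maximizer \<open>a\<close> of \<open>c\<close> on the block and \<open>u - 1\<close> top
  elements outside \<open>R k\<close>.  All its elements except possibly \<open>a\<close> have positive \<open>c\<close>; so only
  \<open>a\<close> can lie in \<open>{j. t \<le> - c j}\<close>, and then the whole block does.
\<close>

lemma exists_greedy_admissible:
  fixes c :: "'n \<Rightarrow> real"
  assumes k: "k \<le> M"
  shows "\<exists>A. admissible k A \<and>
     (\<forall>t>0. level_rank k {j. t \<le> c j} \<le> card (A \<inter> {j. t \<le> c j})) \<and>
     (\<forall>t>0. card (A \<inter> {j. t \<le> - c j}) \<le> of_bool (k < M \<and> R (Suc k) - R k \<subseteq> {j. t \<le> - c j}))"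
proof (cases "k = M")
  case True
  obtain B where B: "B \<subseteq> - R k" "card B \<le> u" "\<forall>j\<in>B. 0 < c j"
    "\<And>t. 0 < t \<Longrightarrow> min (card (- R k \<inter> {j. t \<le> c j})) u \<le> card (B \<inter> {j. t \<le> c j})"
    using exists_top_elements[of "- R k" u c] by auto
  have "{j. t \<le> c j} - R k = - R k \<inter> {j. t \<le> c j}" for t by auto
  moreover have "B \<inter> {j. t \<le> - c j} = {}" if "0 < t" for t using B(3) that by force
  ultimately show ?thesis
    using B True by (intro exI[of _ B]) (auto simp: admissible_def level_rank_def)
next
  case False
  with k have kM: "k < M" by simp
  let ?T = "R (Suc k) - R k"
  have "?T \<noteq> {}" using R_psubset[OF kM] by auto
  then obtain a where a: "a \<in> ?T" "\<And>j. j \<in> ?T \<Longrightarrow> c j \<le> c a"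
    using ex_is_arg_min_if_finite[of ?T "\<lambda>j. - c j"] by (auto simp: is_arg_min_linorder)
  obtain B where B: "B \<subseteq> - R k - {a}" "card B \<le> u - 1" "\<forall>j\<in>B. 0 < c j"
    "\<And>t. 0 < t \<Longrightarrow> min (card ((- R k - {a}) \<inter> {j. t \<le> c j})) (u - 1) \<le> card (B \<inter> {j. t \<le> c j})"
    using exists_top_elements[of "- R k - {a}" "u - 1" c] by auto
  have aB: "a \<notin> B" using B(1) by auto
  have "admissible k (insert a B)"
    using a(1) B(1,2) aB u_pos by (auto simp: admissible_def)
  moreover have "level_rank k {j. t \<le> c j} \<le> card (insert a B \<inter> {j. t \<le> c j})"
    if t: "0 < t" for t
  proof (cases "t \<le> c a")
    case True
    have "{j. t \<le> c j} - R k = insert a ((- R k - {a}) \<inter> {j. t \<le> c j})"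
      "insert a B \<inter> {j. t \<le> c j} = insert a (B \<inter> {j. t \<le> c j})"
      using True a(1) by auto
    then have "card ({j. t \<le> c j} - R k) = Suc (card ((- R k - {a}) \<inter> {j. t \<le> c j}))"
      "card (insert a B \<inter> {j. t \<le> c j}) = Suc (card (B \<inter> {j. t \<le> c j}))"
      using aB by simp_all
    moreover have "\<not> {j. t \<le> c j} \<inter> ?T = {}" using True a(1) by auto
    ultimately show ?thesis using B(4)[OF t] u_pos unfolding level_rank_def by auto
  next
    case False
    then have "{j. t \<le> c j} \<inter> ?T = {}" using a(2) by force
    moreover have "{j. t \<le> c j} - R k = (- R k - {a}) \<inter> {j. t \<le> c j}"
      "insert a B \<inter> {j. t \<le> c j} = B \<inter> {j. t \<le> c j}" using False by auto
    ultimately show ?thesis using B(4)[OF t] kM by (simp add: level_rank_def)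
  qed
  moreover have "card (insert a B \<inter> {j. t \<le> - c j}) \<le> of_bool (k < M \<and> ?T \<subseteq> {j. t \<le> - c j})"
    if t: "0 < t" for t
  proof (cases "t \<le> - c a")
    case True
    then have "?T \<subseteq> {j. t \<le> - c j}" using a(2) by force
    moreover have "insert a B \<inter> {j. t \<le> - c j} = {a}" using True B(3) t by force
    ultimately show ?thesis using kM by simp
  next
    case False
    then have "insert a B \<inter> {j. t \<le> - c j} = {}" using B(3) t by force
    then show ?thesis by (simp only: card.empty)
  qed
  ultimately show ?thesis by blast
qed

text \<open>
  The cover inequalities bound \<open>z(B)\<close> by \<open>\<Sum>k. w k * min u (card (B - R k))\<close>, with \<open>p\<close> the
  first level at which \<open>card (B - R p) < u\<close>.  The level rank is smaller by one on the levels in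
  \<open>L\<close>, those below \<open>p\<close> whose block is missed by \<open>B\<close>.  To gain these terms, apply the cover
  inequality to \<open>B\<close> enlarged by the missed blocks: the right-hand side stays the same because the
  added elements lie in every \<open>R k\<close> with \<open>p \<le> k \<le> M\<close>, while the
  left-hand side grows by at least the sum of \<open>w\<close> over \<open>L\<close>.
\<close>

lemma sum_le_level_rank:
  fixes z :: "'n \<Rightarrow> real" and w :: "nat \<Rightarrow> real"
  assumes hit: "\<And>k. k < M \<Longrightarrow> w k \<le> sum z (R (Suc k) - R k)"
    and cover: "\<And>p B. p \<le> Suc M \<Longrightarrow> (p \<le> M \<Longrightarrow> card (B - R p) < u) \<Longrightarrow>
        sum z B \<le> real u * sum w {..<p} + (\<Sum>k=p..M. real (card (B - R k)) * w k)"
  shows "sum z B \<le> (\<Sum>k\<le>M. w k * real (level_rank k B))"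
proof -
  define p where "p = (LEAST p. p = Suc M \<or> card (B - R p) < u)"
  have p: "p = Suc M \<or> card (B - R p) < u"
    unfolding p_def by (rule LeastI[of _ "Suc M"]) simp
  have p_le: "p \<le> Suc M" unfolding p_def by (rule Least_le) simp
  have below: "u \<le> card (B - R k)" if "k < p" for k
    using not_less_Least[of k "\<lambda>p. p = Suc M \<or> card (B - R p) < u"] that
    by (auto simp: p_def[symmetric] not_less)
  define L where "L = {k. k < p \<and> k < M \<and> B \<inter> (R (Suc k) - R k) = {}}"
  define T where "T k = R (Suc k) - R k" for k
  have sum_blocks: "sum z (\<Union>k\<in>L. T k) = (\<Sum>k\<in>L. sum z (T k))"
    unfolding T_def by (rule sum_Union_blocks) (auto simp: L_def)
  have "sum z (B \<union> (\<Union>k\<in>L. T k)) = sum z B + (\<Sum>k\<in>L. sum z (T k))"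
  proof -
    have "B \<inter> (\<Union>k\<in>L. T k) = {}" by (auto simp: L_def T_def)
    then show ?thesis by (simp add: sum.union_disjoint sum_blocks)
  qed
  moreover have "(\<Sum>k\<in>L. w k) \<le> (\<Sum>k\<in>L. sum z (T k))"
    by (rule sum_mono) (auto simp: L_def T_def intro: hit)
  moreover have same: "(B \<union> (\<Union>k\<in>L. T k)) - R q = B - R q" if "p \<le> q" "q \<le> M" for q
  proof -
    have "T k \<subseteq> R q" if "k \<in> L" for k
      using R_mono[of "Suc k" q] that \<open>p \<le> q\<close> \<open>q \<le> M\<close> by (auto simp: L_def T_def)
    then show ?thesis by blast
  qed
  have "sum z (B \<union> (\<Union>k\<in>L. T k)) \<le> real u * sum w {..<p}
      + (\<Sum>k=p..M. real (card ((B \<union> (\<Union>k\<in>L. T k)) - R k)) * w k)"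
  proof (rule cover[OF p_le])
    assume "p \<le> M"
    then show "card ((B \<union> (\<Union>k\<in>L. T k)) - R p) < u" using p same[of p] by simp
  qed
  moreover have "(\<Sum>k=p..M. real (card ((B \<union> (\<Union>k\<in>L. T k)) - R k)) * w k)
      = (\<Sum>k=p..M. real (card (B - R k)) * w k)"
    by (rule sum.cong) (auto simp: same)
  ultimately have "sum z B \<le> real u * sum w {..<p} - (\<Sum>k\<in>L. w k)
      + (\<Sum>k=p..M. real (card (B - R k)) * w k)"
    by linarith
  also have "\<dots> = (\<Sum>k\<le>M. w k * real (level_rank k B))"
  proof -
    have "(\<Sum>k\<le>M. w k * real (level_rank k B))
        = (\<Sum>k<p. w k * real (level_rank k B)) + (\<Sum>k=p..M. w k * real (level_rank k B))"
    proof -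
      have "{..M} = {..<p} \<union> {p..M}" using p_le by auto
      then show ?thesis by (simp add: sum.union_disjoint ivl_disj_int)
    qed
    moreover have "(\<Sum>k=p..M. w k * real (level_rank k B)) = (\<Sum>k=p..M. real (card (B - R k)) * w k)"
    proof (rule sum.cong)
      fix k assume k: "k \<in> {p..M}"
      have "card (B - R k) \<le> card (B - R p)"
        using R_mono[of p k] k by (intro card_mono) auto
      with p k have "card (B - R k) < u" by auto
      then show "w k * real (level_rank k B) = real (card (B - R k)) * w k"
        by (auto simp: level_rank_def)
    qed simp
    moreover have "(\<Sum>k<p. w k * real (level_rank k B))
        = (\<Sum>k<p. real u * w k - (if k \<in> L then w k else 0))"
    proof (rule sum.cong)
      fix k assume k: "k \<in> {..<p}"
      then have "level_rank k B = (if k \<in> L then u - 1 else u)"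
        using below[of k] u_pos by (auto simp: level_rank_def L_def)
      then show "w k * real (level_rank k B) = real u * w k - (if k \<in> L then w k else 0)"
        using u_pos by (simp add: of_nat_diff algebra_simps)
    qed simp
    moreover have "{..<p} \<inter> L = L" by (auto simp: L_def)
    ultimately show ?thesis
      by (simp add: sum_subtractf sum_distrib_left sum.inter_restrict[symmetric])
  qed
  finally show ?thesis .
qed

lemma sum_ge_contained_blocks:
  fixes z :: "'n \<Rightarrow> real" and w :: "nat \<Rightarrow> real"
  assumes z: "\<And>j. 0 \<le> z j"
    and hit: "\<And>k. k < M \<Longrightarrow> w k \<le> sum z (R (Suc k) - R k)"
  shows "(\<Sum>k\<le>M. w k * of_bool (k < M \<and> R (Suc k) - R k \<subseteq> B)) \<le> sum z B"
proof -
  define L where "L = {k. k < M \<and> R (Suc k) - R k \<subseteq> B}"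
  have "(\<Sum>k\<le>M. w k * of_bool (k < M \<and> R (Suc k) - R k \<subseteq> B)) = sum w L"
    by (rule sum.mono_neutral_cong_right) (auto simp: L_def)
  also have "\<dots> \<le> (\<Sum>k\<in>L. sum z (R (Suc k) - R k))"
    by (rule sum_mono) (auto simp: L_def intro: hit)
  also have "\<dots> = sum z (\<Union>k\<in>L. R (Suc k) - R k)"
    by (rule sum_Union_blocks[symmetric]) (auto simp: L_def)
  also have "\<dots> \<le> sum z B"
    by (rule sum_mono2) (auto simp: L_def z)
  finally show ?thesis .
qed

text \<open>
  The signed measure \<open>d = (\<Sum>k\<le>M. w k * A k) - z\<close> is nonnegative on the upper level sets of the
  positive part of \<open>c\<close> and nonpositive on those of the negative part, so the layer-cake principle
  applies to both parts.  The hypothesis on \<open>p\<close> and \<open>B\<close> treats uniformly the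
  cover inequalities, the sums of upper bounds on single entries of \<open>z\<close> (\<open>p = 0\<close>) and the
  cardinality constraint (\<open>p = Suc M\<close>).
\<close>

lemma exists_dominating_admissible:
  fixes z c :: "'n \<Rightarrow> real" and w :: "nat \<Rightarrow> real"
  assumes z: "\<And>j. 0 \<le> z j"
    and w: "\<And>k. k \<le> M \<Longrightarrow> 0 \<le> w k"
    and hit: "\<And>k. k < M \<Longrightarrow> w k \<le> sum z (R (Suc k) - R k)"
    and cover: "\<And>p B. p \<le> Suc M \<Longrightarrow> (p \<le> M \<Longrightarrow> card (B - R p) < u) \<Longrightarrow>
        sum z B \<le> real u * sum w {..<p} + (\<Sum>k=p..M. real (card (B - R k)) * w k)"
  shows "\<exists>A. (\<forall>k\<le>M. admissible k (A k)) \<and>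
           (\<Sum>j\<in>UNIV. c j * z j) \<le> (\<Sum>j\<in>UNIV. c j * (\<Sum>k\<le>M. w k * of_bool (j \<in> A k)))"
proof -
  have "\<forall>k\<in>{..M}. \<exists>A. admissible k A \<and>
     (\<forall>t>0. level_rank k {j. t \<le> c j} \<le> card (A \<inter> {j. t \<le> c j})) \<and>
     (\<forall>t>0. card (A \<inter> {j. t \<le> - c j}) \<le> of_bool (k < M \<and> R (Suc k) - R k \<subseteq> {j. t \<le> - c j}))"
    using exists_greedy_admissible by simp
  from bchoice[OF this] obtain A where
    adm: "\<And>k. k \<le> M \<Longrightarrow> admissible k (A k)" and
    up: "\<And>k t. k \<le> M \<Longrightarrow> 0 < t \<Longrightarrow>
        level_rank k {j. t \<le> c j} \<le> card (A k \<inter> {j. t \<le> c j})" and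
    lo: "\<And>k t. k \<le> M \<Longrightarrow> 0 < t \<Longrightarrow> card (A k \<inter> {j. t \<le> - c j})
        \<le> of_bool (k < M \<and> R (Suc k) - R k \<subseteq> {j. t \<le> - c j})"
    by auto
  define d where "d j = (\<Sum>k\<le>M. w k * of_bool (j \<in> A k)) - z j" for j
  have sum_d: "sum d B = (\<Sum>k\<le>M. w k * real (card (A k \<inter> B))) - sum z B" for B
  proof -
    have "(\<Sum>j\<in>B. \<Sum>k\<le>M. w k * of_bool (j \<in> A k)) = (\<Sum>k\<le>M. \<Sum>j\<in>B. w k * of_bool (j \<in> A k))"
      by (rule sum.swap)
    also have "\<dots> = (\<Sum>k\<le>M. w k * real (card (A k \<inter> B)))"
      by (simp add: sum_distrib_left[symmetric] Int_commute)
    finally show ?thesis by (simp add: d_def sum_subtractf)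
  qed
  have pos: "0 \<le> (\<Sum>j\<in>UNIV. max 0 (c j) * d j)"
  proof (rule sum_mult_nonneg_by_level_sets)
    fix t :: real assume t: "0 < t"
    have "sum z {j. t \<le> c j} \<le> (\<Sum>k\<le>M. w k * real (level_rank k {j. t \<le> c j}))"
      by (rule sum_le_level_rank[OF hit cover])
    also have "\<dots> \<le> (\<Sum>k\<le>M. w k * real (card (A k \<inter> {j. t \<le> c j})))"
      by (intro sum_mono mult_left_mono) (auto intro: up[OF _ t] w)
    finally have "0 \<le> sum d {j. t \<le> c j}" by (simp add: sum_d)
    moreover have "{j. t \<le> max 0 (c j)} = {j. t \<le> c j}" using t by auto
    ultimately show "0 \<le> sum d {j. t \<le> max 0 (c j)}" by simp
  qed simp
  have neg: "0 \<le> (\<Sum>j\<in>UNIV. max 0 (- c j) * (- d j))"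
  proof (rule sum_mult_nonneg_by_level_sets)
    fix t :: real assume t: "0 < t"
    have "(\<Sum>k\<le>M. w k * real (card (A k \<inter> {j. t \<le> - c j})))
        \<le> (\<Sum>k\<le>M. w k * of_bool (k < M \<and> R (Suc k) - R k \<subseteq> {j. t \<le> - c j}))"
    proof (intro sum_mono mult_left_mono)
      fix k assume "k \<in> {..M}"
      then have "k \<le> M" by simp
      from of_nat_mono[OF lo[OF this t], where 'a = real]
      show "real (card (A k \<inter> {j. t \<le> - c j}))
        \<le> of_bool (k < M \<and> R (Suc k) - R k \<subseteq> {j. t \<le> - c j})" by (simp only: of_nat_of_bool)
    qed (auto intro: w)
    also have "\<dots> \<le> sum z {j. t \<le> - c j}"
      by (rule sum_ge_contained_blocks[OF z hit])
    finally have "0 \<le> sum (\<lambda>j. - d j) {j. t \<le> - c j}" by (simp add: sum_d sum_negf)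
    moreover have "{j. t \<le> max 0 (- c j)} = {j. t \<le> - c j}" using t by auto
    ultimately show "0 \<le> sum (\<lambda>j. - d j) {j. t \<le> max 0 (- c j)}" by simp
  qed simp
  have "c j * d j = max 0 (c j) * d j + max 0 (- c j) * (- d j)" for j
    by (auto simp: max_def)
  then have "0 \<le> (\<Sum>j\<in>UNIV. c j * d j)"
    using pos neg by (simp only: sum.distrib)
  then have "(\<Sum>j\<in>UNIV. c j * z j) \<le> (\<Sum>j\<in>UNIV. c j * (\<Sum>k\<le>M. w k * of_bool (j \<in> A k)))"
    by (simp add: d_def right_diff_distrib sum_subtractf)
  with adm show ?thesis by blast
qed

end

section \<open>Feasible points and their cover inequalities\<close>

lemma linear_le_on_convex_hull:
  fixes f :: "'a::real_vector \<Rightarrow> real"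
  assumes "linear f" and "\<And>x. x \<in> X \<Longrightarrow> f x \<le> b" and "x \<in> convex hull X"
  shows "f x \<le> b"
proof -
  have "convex (f -` {..b})" using assms(1) by (rule convex_linear_vimage) simp
  then have "convex hull X \<subseteq> f -` {..b}" using assms(2) by (intro hull_minimal) auto
  then show ?thesis using assms(3) by auto
qed

text \<open>
  Passes from the coefficients of \<open>\<delta>\<close> in a cover inequality to those of the weights
  \<open>d k - d (Suc k)\<close> of the levels.
\<close>

lemma sum_by_parts:
  fixes f d :: "nat \<Rightarrow> real"
  assumes "p \<le> M"
  shows "(\<Sum>i=p+1..M. (f (i - 1) - f i) * d i)
    = f p * d p - f M * d (Suc M) - (\<Sum>k=p..M. f k * (d k - d (Suc k)))"
  using assms
proof (induction M rule: dec_induct)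
  case base
  show ?case by (simp add: algebra_simps)
next
  case (step M)
  then show ?case by (simp add: algebra_simps)
qed


definition vertex :: "(nat \<Rightarrow> 'm::finite) \<Rightarrow> (nat \<Rightarrow> 'n::finite set) \<Rightarrow> 'n set \<Rightarrow> (real^'n) \<times> (real^'m)" where
  "vertex e S A = (\<chi> j. of_bool (j \<in> A),
     \<chi> x. of_bool (A \<inter> S (inv_into {1..CARD('m)} e x) = {}))"

lemma fst_vertex [simp]: "fst (vertex e S A) $ j = of_bool (j \<in> A)"
  by (simp add: vertex_def)

lemma snd_vertex:
  fixes e :: "nat \<Rightarrow> 'm::finite"
  assumes "bij_betw e {1..CARD('m)} UNIV" and "i \<in> {1..CARD('m)}"
  shows "snd (vertex e S A) $ e i = of_bool (A \<inter> S i = {})"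
  using assms by (simp add: vertex_def bij_betw_inv_into_left)

lemma X0_eq_vertex_image:
  fixes e :: "nat \<Rightarrow> 'm::finite" and S :: "nat \<Rightarrow> 'n::finite set"
  assumes e: "bij_betw e {1..CARD('m)} UNIV"
  shows "X0 e S u = vertex e S ` {A. card A \<le> u}"
proof -
  have prod: "(\<Prod>j\<in>T. 1 - of_bool (j \<in> A)) = (of_bool (A \<inter> T = {}) :: real)" for A T :: "'n set"
  proof (cases "A \<inter> T = {}")
    case True
    then have "(\<Prod>j\<in>T. 1 - of_bool (j \<in> A)) = (\<Prod>j\<in>T. 1 :: real)"
      by (intro prod.cong) auto
    then show ?thesis using True by simp
  next
    case False
    then show ?thesis by (auto simp: prod_zero_iff)
  qed
  show ?thesis
  proof (intro set_eqI iffI)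
    fix x assume "x \<in> X0 e S u"
    then obtain z d where x: "x = (z, d)" and z: "\<And>j. z $ j \<in> {0, 1}"
      and d: "\<And>i. i \<in> {1..CARD('m)} \<Longrightarrow> d $ e i = (\<Prod>j\<in>S i. 1 - z $ j)"
      and le: "(\<Sum>j\<in>UNIV. z $ j) \<le> real u"
      by (auto simp: X0_def)
    define A where "A = {j. z $ j = 1}"
    have zA: "z $ j = of_bool (j \<in> A)" for j using z[of j] by (auto simp: A_def)
    have "d $ y = snd (vertex e S A) $ y" for y
    proof -
      obtain i where i: "i \<in> {1..CARD('m)}" "y = e i"
        using e by (metis UNIV_I bij_betw_imp_surj_on imageE)
      show ?thesis using d[OF i(1)] i by (simp add: zA prod snd_vertex[OF e])
    qed
    then have "x = vertex e S A"
      by (auto simp: x prod_eq_iff vec_eq_iff zA)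
    moreover have "card A \<le> u" using le by (simp add: zA)
    ultimately show "x \<in> vertex e S ` {A. card A \<le> u}" by blast
  next
    fix x assume "x \<in> vertex e S ` {A. card A \<le> u}"
    then obtain A where A: "x = vertex e S A" "card A \<le> u" by auto
    obtain z d where zd: "vertex e S A = (z, d)" by force
    have "z $ j = of_bool (j \<in> A)" for j using fst_vertex[of e S A j] zd by simp
    moreover have "d $ e i = of_bool (A \<inter> S i = {})" if "i \<in> {1..CARD('m)}" for i
      using snd_vertex[OF e that, of S A] zd by simp
    ultimately show "x \<in> X0 e S u" using A zd by (simp add: X0_def prod)
  qed
qed

text \<open>
  With \<open>b = card (B \<inter> A)\<close> and \<open>d\<close> the indicator of \<open>A \<inter> S k = {}\<close>, summation by parts turns the left-hand
  side into \<open>b + u * d p - (\<Sum>k=p..M. card (B - S k) * (d k - d (Suc k)))\<close>.  A difference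
  \<open>d k - d (Suc k)\<close> is nonzero only if \<open>A\<close> avoids \<open>S k\<close>, and then \<open>b \<le> card (B - S k)\<close>; so the
  last sum is at least \<open>b * d p\<close>, and \<open>b + (u - b) * d p \<le> u\<close> remains.
\<close>

lemma cover_inequality_for_set:
  fixes S :: "nat \<Rightarrow> 'n::finite set"
  assumes p: "p \<le> M" and mono: "\<And>k. p \<le> k \<Longrightarrow> k < M \<Longrightarrow> S k \<subseteq> S (Suc k)"
    and A: "card A \<le> u"
  shows "real (card (B \<inter> A)) + (real u - real (card (B - S p))) * of_bool (A \<inter> S p = {})
    + (\<Sum>i=p+1..M. (real (card (B - S (i - 1))) - real (card (B - S i))) * of_bool (A \<inter> S i = {}))
    \<le> real u"
proof -
  define d :: "nat \<Rightarrow> real" where "d k = (if k \<le> M then of_bool (A \<inter> S k = {}) else 0)" for k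
  define b where "b = real (card (B \<inter> A))"
  have "(\<Sum>i=p+1..M. (real (card (B - S (i - 1))) - real (card (B - S i))) * of_bool (A \<inter> S i = {}))
      = (\<Sum>i=p+1..M. (real (card (B - S (i - 1))) - real (card (B - S i))) * d i)"
    by (rule sum.cong) (auto simp: d_def)
  also have "\<dots> = real (card (B - S p)) * d p
      - (\<Sum>k=p..M. real (card (B - S k)) * (d k - d (Suc k)))"
    using sum_by_parts[OF p, of "\<lambda>k. real (card (B - S k))" d] by (simp add: d_def)
  finally have parts: "(\<Sum>i=p+1..M. (real (card (B - S (i - 1))) - real (card (B - S i)))
        * of_bool (A \<inter> S i = {}))
      = real (card (B - S p)) * d p - (\<Sum>k=p..M. real (card (B - S k)) * (d k - d (Suc k)))" .
  have "b * d p = (\<Sum>k=p..M. b * (d k - d (Suc k)))"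
    using sum_by_parts[OF p, of "\<lambda>_. b" d] by (simp add: d_def)
  also have "\<dots> \<le> (\<Sum>k=p..M. real (card (B - S k)) * (d k - d (Suc k)))"
  proof (rule sum_mono)
    fix k assume k: "k \<in> {p..M}"
    have "A \<inter> S k = {}" if "k < M" "A \<inter> S (Suc k) = {}"
      using mono[of k] k that by auto
    then have d_Suc: "d (Suc k) \<le> d k" by (simp add: d_def)
    moreover have "b \<le> real (card (B - S k))" if "d k \<noteq> 0"
    proof -
      have "B \<inter> A \<subseteq> B - S k" using that by (auto simp: d_def split: if_splits)
      then show ?thesis by (simp add: b_def card_mono)
    qed
    moreover have "0 \<le> d (Suc k)" by (simp add: d_def)
    ultimately show "b * (d k - d (Suc k)) \<le> real (card (B - S k)) * (d k - d (Suc k))"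
      using d_Suc by (cases "d k = 0") (auto intro: mult_right_mono)
  qed
  finally have "b * d p \<le> (\<Sum>k=p..M. real (card (B - S k)) * (d k - d (Suc k)))" .
  moreover have "b + (real u - b) * d p \<le> real u"
  proof -
    have "card (B \<inter> A) \<le> card A" by (simp add: card_mono)
    then have "b \<le> real u" using A by (simp add: b_def)
    then show ?thesis by (auto simp: d_def)
  qed
  moreover have "of_bool (A \<inter> S p = {}) = d p" using p by (simp add: d_def)
  ultimately show ?thesis
    by (simp only: parts b_def[symmetric]) (simp add: algebra_simps)
qed

section \<open>The convex hull\<close>

theorem theorem10:
  fixes e :: "nat \<Rightarrow> 'm::finite"
    and S :: "nat \<Rightarrow> 'n::finite set"
    and u :: nat
  assumes e: "bij_betw e {1..CARD('m)} UNIV"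
    and nested: "nested_family TYPE('m) S"
    and u: "2 \<le> u"
  shows "convex hull (X0 e S u) = {(z :: real^'n, \<delta> :: real^'m).
      0 \<le> (\<Sum>j\<in>UNIV. z $ j) \<and> (\<Sum>j\<in>UNIV. z $ j) \<le> real u \<and>
      (\<forall>i\<in>{1..CARD('m)}. \<forall>j\<in>S i. z $ j + \<delta> $ e i \<le> 1) \<and>
      1 - \<delta> $ e 1 - (\<Sum>j\<in>S 1. z $ j) \<le> 0 \<and>
      (\<forall>i\<in>{1..<CARD('m)}. \<delta> $ e (i + 1) - \<delta> $ e i \<le> 0) \<and>
      (\<forall>i\<in>{1..<CARD('m)}.
         \<delta> $ e i - \<delta> $ e (i + 1) - (\<Sum>j\<in>S (i + 1) - S i. z $ j) \<le> 0) \<and>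
      - \<delta> $ e CARD('m) \<le> 0 \<and>
      (\<forall>j. - z $ j \<le> 0) \<and>
      (\<forall>j\<in>UNIV - S CARD('m). z $ j \<le> 1) \<and>
      (\<forall>p\<in>{1..CARD('m)}. \<forall>S'. card (S' - S p) \<le> u - 1 \<longrightarrow>
         (\<Sum>j\<in>S'. z $ j) + (real u - real (card (S' - S p))) * \<delta> $ e p
         + (\<Sum>i\<in>{p+1..CARD('m)}.
              (real (card (S' - S (i - 1))) - real (card (S' - S i))) * \<delta> $ e i)
         \<le> real u)}"
proof -
  let ?M = "CARD('m)"
  have M: "1 \<le> ?M" by (simp add: Suc_leI)
  define V where "V = {A :: 'n set. card A \<le> u}"
  have X0: "X0 e S u = vertex e S ` V"
    unfolding V_def by (rule X0_eq_vertex_image[OF e])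
  have S_step: "S i \<subset> S (i + 1)" if "i \<in> {1..<?M}" for i
    using nested that by (auto simp: nested_family_def)
  then have S_mono: "S i \<subseteq> S (Suc i)" if "1 \<le> i" "i < ?M" for i
    using that by (simp add: psubset_imp_subset)
  have S1: "S 1 \<noteq> {}" using nested by (auto simp: nested_family_def)
  note vx = snd_vertex[OF e]
  show ?thesis (is "_ = ?P")
  proof (intro subset_antisym subsetI)
    fix x assume "x \<in> convex hull X0 e S u"
    then have x: "x \<in> convex hull (vertex e S ` V)" by (simp add: X0)
    obtain z d where zd: "x = (z, d)" by force
    \<comment> \<open>Linear inequalities need only be checked on the feasible points.\<close>
    have valid: "f (z, d) \<le> b" if "linear f" "\<And>A. A \<in> V \<Longrightarrow> f (vertex e S A) \<le> b"
      for f :: "(real^'n) \<times> (real^'m) \<Rightarrow> real" and b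
      by (rule linear_le_on_convex_hull[OF that(1) _ x[unfolded zd]]) (use that(2) in blast)
    have 1: "- z $ j \<le> 0" for j
      using valid[of "\<lambda>x. - fst x $ j" 0] by (simp add: linear_iff)
    have 2: "(\<Sum>j\<in>UNIV. z $ j) \<le> real u"
      using valid[of "\<lambda>x. \<Sum>j\<in>UNIV. fst x $ j" "real u"]
      by (simp add: linear_iff sum.distrib sum_distrib_left V_def)
    have 3: "z $ j + d $ e i \<le> 1" if "i \<in> {1..?M}" "j \<in> S i" for i j
    proof -
      have "of_bool (j \<in> A) + of_bool (A \<inter> S i = {}) \<le> (1 :: real)" for A
        using that by auto
      then show ?thesis
        using valid[of "\<lambda>x. fst x $ j + snd x $ e i" 1] that
        by (simp add: linear_iff algebra_simps vx)
    qed
    have 4: "1 - d $ e 1 - (\<Sum>j\<in>S 1. z $ j) \<le> 0"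
    proof -
      let ?f = "\<lambda>x::(real^'n) \<times> (real^'m). - snd x $ e 1 - (\<Sum>j\<in>S 1. fst x $ j)"
      have "?f (z, d) \<le> - 1"
      proof (rule valid)
        show "linear ?f"
          by (simp add: linear_iff algebra_simps sum.distrib sum_distrib_left)
        fix A
        have "1 \<le> card (S 1 \<inter> A)" if "A \<inter> S 1 \<noteq> {}"
          using that by (simp add: Suc_le_eq card_gt_0_iff Int_commute)
        then show "?f (vertex e S A) \<le> - 1"
          using M vx[of 1 S A] by auto
      qed
      then show ?thesis by simp
    qed
    have 5: "d $ e (i + 1) - d $ e i \<le> 0" if "i \<in> {1..<?M}" for i
      using valid[of "\<lambda>x. snd x $ e (i + 1) - snd x $ e i" 0] that S_step[OF that]
        vx[of i S] vx[of "i + 1" S]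
      by (auto simp: linear_iff algebra_simps)
    have 6: "d $ e i - d $ e (i + 1) - (\<Sum>j\<in>S (i + 1) - S i. z $ j) \<le> 0" if i: "i \<in> {1..<?M}" for i
    proof -
      let ?f = "\<lambda>x::(real^'n) \<times> (real^'m).
        snd x $ e i - snd x $ e (i + 1) - (\<Sum>j\<in>S (i + 1) - S i. fst x $ j)"
      have "?f (z, d) \<le> 0"
      proof (rule valid)
        show "linear ?f"
          by (simp add: linear_iff algebra_simps sum.distrib sum_distrib_left)
        fix A
        have "1 \<le> card ((S (i + 1) - S i) \<inter> A)" if "A \<inter> S i = {}" "A \<inter> S (i + 1) \<noteq> {}"
          using that by (auto simp: Suc_le_eq card_gt_0_iff)
        then show "?f (vertex e S A) \<le> 0"
          using i vx[of i S A] vx[of "i + 1" S A] by auto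
      qed
      then show ?thesis by simp
    qed
    have 7: "- d $ e ?M \<le> 0"
      using valid[of "\<lambda>x. - snd x $ e ?M" 0] M by (simp add: linear_iff vx)
    have 8: "z $ j \<le> 1" for j
      using valid[of "\<lambda>x. fst x $ j" 1] by (simp add: linear_iff)
    have 9: "(\<Sum>j\<in>S'. z $ j) + (real u - real (card (S' - S p))) * d $ e p
         + (\<Sum>i\<in>{p+1..?M}. (real (card (S' - S (i - 1))) - real (card (S' - S i))) * d $ e i)
         \<le> real u" if p: "p \<in> {1..?M}" for p S'
    proof -
      let ?f = "\<lambda>x::(real^'n) \<times> (real^'m).
        (\<Sum>j\<in>S'. fst x $ j) + (real u - real (card (S' - S p))) * snd x $ e p
         + (\<Sum>i\<in>{p+1..?M}. (real (card (S' - S (i - 1))) - real (card (S' - S i))) * snd x $ e i)"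
      have "?f (z, d) \<le> real u"
      proof (rule valid)
        show "linear ?f"
          by (simp add: linear_iff algebra_simps sum.distrib sum_subtractf sum_distrib_left)
        fix A assume A: "A \<in> V"
        have "(\<Sum>i\<in>{p+1..?M}. (real (card (S' - S (i - 1))) - real (card (S' - S i))) * snd (vertex e S A) $ e i)
            = (\<Sum>i\<in>{p+1..?M}. (real (card (S' - S (i - 1))) - real (card (S' - S i))) * of_bool (A \<inter> S i = {}))"
          by (rule sum.cong) (auto simp: vx)
        then show "?f (vertex e S A) \<le> real u"
          using cover_inequality_for_set[of p ?M S A u S'] p A S_mono vx[OF p, of S A]
          by (simp add: V_def)
      qed
      then show ?thesis by simp
    qed
    have "0 \<le> (\<Sum>j\<in>UNIV. z $ j)" using 1 by (simp add: sum_nonneg)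
    then show "x \<in> ?P" using 1 2 3 4 5 6 7 8 9 by (simp add: zd)
  next
    fix x assume "x \<in> ?P"
    then obtain z d where x: "x = (z, d)"
      and card_le: "(\<Sum>j\<in>UNIV. z $ j) \<le> real u"
      and zd: "\<And>i j. i \<in> {1..?M} \<Longrightarrow> j \<in> S i \<Longrightarrow> z $ j + d $ e i \<le> 1"
      and first: "1 - d $ e 1 - (\<Sum>j\<in>S 1. z $ j) \<le> 0"
      and decr: "\<And>i. i \<in> {1..<?M} \<Longrightarrow> d $ e (i + 1) - d $ e i \<le> 0"
      and block: "\<And>i. i \<in> {1..<?M} \<Longrightarrow>
         d $ e i - d $ e (i + 1) - (\<Sum>j\<in>S (i + 1) - S i. z $ j) \<le> 0"
      and last: "- d $ e ?M \<le> 0"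
      and z_nonneg: "\<And>j. 0 \<le> z $ j"
      and z_le: "\<And>j. j \<notin> S ?M \<Longrightarrow> z $ j \<le> 1"
      and cover: "\<And>p S'. p \<in> {1..?M} \<Longrightarrow> card (S' - S p) \<le> u - 1 \<Longrightarrow>
         (\<Sum>j\<in>S'. z $ j) + (real u - real (card (S' - S p))) * d $ e p
         + (\<Sum>i\<in>{p+1..?M}.
              (real (card (S' - S (i - 1))) - real (card (S' - S i))) * d $ e i)
         \<le> real u"
      by auto
    \<comment> \<open>The levels: \<open>R\<close> prepends the empty set to the family, \<open>D\<close> is \<open>\<delta>\<close> continued by \<open>1\<close> and \<open>0\<close>,
      and \<open>w k\<close> is the weight that any convex combination must put on level \<open>k\<close>.\<close>
    define R where "R k = (if k = 0 then {} else S k)" for k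
    define D where "D k = (if k = 0 then 1 else if k \<le> ?M then d $ e k else 0)" for k
    define w where "w k = D k - D (Suc k)" for k
    interpret set_chain R ?M u
    proof
      fix k assume "k < ?M"
      then show "R k \<subset> R (Suc k)" using S_step[of k] S1 by (auto simp: R_def)
    qed (use u in \<open>auto simp: R_def\<close>)
    have D_last: "D (Suc ?M) = 0" by (simp add: D_def)
    have sum_w: "sum w {..<p} = 1 - D p" for p
    proof (induction p)
      case 0 then show ?case by (simp add: D_def)
    next
      case (Suc p) then show ?case by (simp add: w_def)
    qed
    have sum_w_ge: "(\<Sum>k=p..?M. w k) = D p" if "p \<le> ?M" for p
      using sum_by_parts[OF that, of "\<lambda>_. 1" D] by (simp add: D_last w_def)
    have S1_bound: "d $ e 1 \<le> 1"
    proof -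
      obtain j where "j \<in> S 1" using S1 by auto
      then show ?thesis using zd[of 1 j] M z_nonneg[of j] by auto
    qed
    have w_nonneg: "0 \<le> w k" if "k \<le> ?M" for k
    proof (cases "k = ?M")
      case True
      then show ?thesis using last M by (simp add: w_def D_def)
    next
      case False
      then show ?thesis using decr[of k] S1_bound that by (auto simp: w_def D_def)
    qed
    have hit: "w k \<le> sum (($) z) (R (Suc k) - R k)" if "k < ?M" for k
      using first block[of k] that M by (auto simp: w_def D_def R_def)
    \<comment> \<open>If \<open>q\<close> is the first level with \<open>j \<in> R q\<close>, the right-hand side is at least \<open>1 - D q\<close>; the
      default \<open>Suc m\<close> stands for an element outside all members, where \<open>z\<close> is bounded by \<open>1\<close>.\<close>
    have z_le_w: "z $ j \<le> (\<Sum>k\<le>?M. w k * of_bool (j \<notin> R k))" for j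
    proof -
      define q where "q = (LEAST q. q = Suc ?M \<or> j \<in> R q)"
      have q: "q = Suc ?M \<or> j \<in> R q"
        unfolding q_def by (rule LeastI[of _ "Suc ?M"]) simp
      have q_le: "q \<le> Suc ?M" unfolding q_def by (rule Least_le) simp
      have notin: "j \<notin> R k" if "k < q" for k
        using not_less_Least[of k "\<lambda>q. q = Suc ?M \<or> j \<in> R q"] that by (auto simp: q_def[symmetric])
      have "z $ j \<le> 1 - D q"
      proof (cases "q = Suc ?M")
        case True
        then have "j \<notin> S ?M" using notin[of ?M] M by (auto simp: R_def)
        then show ?thesis using z_le True by (simp add: D_last)
      next
        case False
        with q q_le have "q \<noteq> 0" "q \<le> ?M" "j \<in> S q" by (auto simp: R_def split: if_splits)
        then show ?thesis using zd[of q j] by (auto simp: D_def)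
      qed
      also have "\<dots> = (\<Sum>k<q. w k * of_bool (j \<notin> R k))"
        unfolding sum_w[symmetric] by (rule sum.cong) (auto simp: notin)
      also have "\<dots> \<le> (\<Sum>k\<le>?M. w k * of_bool (j \<notin> R k))"
        by (rule sum_mono2) (use q_le w_nonneg in auto)
      finally show ?thesis .
    qed
    have cover': "sum (($) z) B \<le> real u * sum w {..<p} + (\<Sum>k=p..?M. real (card (B - R k)) * w k)"
      if p: "p \<le> Suc ?M" and B: "p \<le> ?M \<Longrightarrow> card (B - R p) < u" for p B
    proof -
      consider "p = 0" | "p = Suc ?M" | "p \<in> {1..?M}" using p by force
      then show ?thesis
      proof cases
        case 1
        have "sum (($) z) B \<le> (\<Sum>j\<in>B. \<Sum>k\<le>?M. w k * of_bool (j \<notin> R k))"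
          by (intro sum_mono z_le_w)
        also have "\<dots> = (\<Sum>k\<le>?M. \<Sum>j\<in>B. w k * of_bool (j \<notin> R k))"
          by (rule sum.swap)
        also have "\<dots> = (\<Sum>k\<le>?M. real (card (B - R k)) * w k)"
          by (simp add: sum_distrib_left[symmetric] Diff_eq Compl_eq mult.commute)
        finally show ?thesis using 1 by (simp add: atMost_atLeast0)
      next
        case 2
        have "sum (($) z) B \<le> (\<Sum>j\<in>UNIV. z $ j)"
          by (rule sum_mono2) (auto simp: z_nonneg)
        moreover have "sum w {..<p} = 1" using 2 by (simp only: sum_w D_last)
        ultimately show ?thesis using 2 card_le by simp
      next
        case 3
        have "(\<Sum>i\<in>{p+1..?M}. (real (card (B - S (i - 1))) - real (card (B - S i))) * d $ e i)
          = (\<Sum>i\<in>{p+1..?M}. (real (card (B - R (i - 1))) - real (card (B - R i))) * D i)"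
          by (rule sum.cong) (use 3 in \<open>auto simp: R_def D_def\<close>)
        also have "\<dots> = real (card (B - R p)) * D p - (\<Sum>k=p..?M. real (card (B - R k)) * w k)"
          using sum_by_parts[of p ?M "\<lambda>k. real (card (B - R k))" D] 3 by (simp add: D_last w_def)
        finally have "(\<Sum>i\<in>{p+1..?M}. (real (card (B - S (i - 1))) - real (card (B - S i))) * d $ e i)
          = real (card (B - R p)) * D p - (\<Sum>k=p..?M. real (card (B - R k)) * w k)" .
        moreover have "d $ e p = D p" "S p = R p" using 3 by (auto simp: D_def R_def)
        moreover have "card (B - S p) \<le> u - 1" using B 3 \<open>S p = R p\<close> by auto
        ultimately show ?thesis using cover[OF 3, of B] by (simp add: sum_w algebra_simps)
      qed
    qed
    show "x \<in> convex hull X0 e S u"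
    proof (rule ccontr)
      assume "x \<notin> convex hull X0 e S u"
      moreover have "finite (X0 e S u)" by (simp add: X0)
      then have "closed (convex hull X0 e S u)"
        by (simp add: finite_imp_compact_convex_hull compact_imp_closed)
      ultimately obtain c b where sep: "inner c x < b" "\<And>y. y \<in> convex hull X0 e S u \<Longrightarrow> b < inner c y"
        using separating_hyperplane_closed_point[OF convex_convex_hull] by blast
      obtain A where adm: "\<And>k. k \<le> ?M \<Longrightarrow> admissible k (A k)"
        and A_le: "(\<Sum>j\<in>UNIV. - fst c $ j * z $ j)
           \<le> (\<Sum>j\<in>UNIV. - fst c $ j * (\<Sum>k\<le>?M. w k * of_bool (j \<in> A k)))"
        using exists_dominating_admissible[of "($) z" w "\<lambda>j. - fst c $ j", OF z_nonneg w_nonneg hit cover']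
        by blast
      \<comment> \<open>A point of the hull with the same \<open>\<delta>\<close> as \<open>x\<close> and no larger value of the functional;
        \<open>A\<close> was chosen for \<open>- fst c\<close> since the hull is on the upper side.\<close>
      define y where "y = (\<Sum>k\<le>?M. w k *\<^sub>R vertex e S (A k))"
      have "y \<in> convex hull X0 e S u"
        unfolding y_def
      proof (rule convex_sum[OF _ convex_convex_hull])
        show "sum w {..?M} = 1" using sum_w_ge[of 0] by (simp add: atMost_atLeast0 D_def)
        fix k assume k: "k \<in> {..?M}"
        then have "vertex e S (A k) \<in> X0 e S u"
          using adm[of k] by (auto simp: X0 V_def admissible_def)
        then show "vertex e S (A k) \<in> convex hull X0 e S u" by (rule hull_inc)
        show "0 \<le> w k" using k w_nonneg by simp
      qed simp
      then have "inner c x < inner c y" using sep(1) sep(2)[of y] by linarith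
      have y_fst: "fst y $ j = (\<Sum>k\<le>?M. w k * of_bool (j \<in> A k))" for j
        by (simp add: y_def fst_sum)
      have y_snd: "snd y = d"
      proof (subst vec_eq_iff, intro allI)
        fix a
        obtain i where i: "i \<in> {1..?M}" "a = e i"
          using e by (metis UNIV_I bij_betw_imp_surj_on imageE)
        have avoid: "A k \<inter> S i = {} \<longleftrightarrow> i \<le> k" if "k \<le> ?M" for k
        proof (cases "i \<le> k")
          case True
          then show ?thesis
            using R_mono[of i k] adm[OF that] that i by (auto simp: admissible_def R_def)
        next
          case False
          then show ?thesis
            using R_mono[of "Suc k" i] adm[OF that] that i by (auto simp: admissible_def R_def)
        qed
        have "snd y $ a = (\<Sum>k\<le>?M. w k * of_bool (i \<le> k))"
          using i by (simp add: y_def snd_sum vx avoid)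
        also have "\<dots> = (\<Sum>k=i..?M. w k)"
          by (rule sum.mono_neutral_cong_right) auto
        also have "\<dots> = d $ a" using sum_w_ge[of i] i by (simp add: D_def)
        finally show "snd y $ a = d $ a" .
      qed
      have "inner (fst c) (fst y) \<le> inner (fst c) z"
        using A_le by (simp add: inner_vec_def y_fst sum_negf)
      then have "inner c y \<le> inner c x"
        by (simp add: inner_prod_def x y_snd)
      with \<open>inner c x < inner c y\<close> show False by simp
    qed
  qed
qed

end
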